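(* Let $\overline{N}=\{N,+,\times,<,0,1\}$ be the natural number structure, let $n>0$ be a natural number, and let $\overline{N}^{n}$ and $\overline{N}_{n}$ be the external and internal representations of the structure scaled by $n$. Then $\overline{N}_{n}$ satisfies the axioms of arithmetic if and only if $\overline{N}^{n}$ does if and only if $\overline{N}$ does.
   Context: The axioms of arithmetic are here the axioms for the nonnegative elements of a discretely ordered commutative ring with identity, in the language $\{+,\times,<,0,1\}$: $+$ and $\times$ are associative and commutative, $\times$ distributes over $+$, $0$ is an identity for $+$ and $a\times 0=0$, $1$ is an identity for $\times$; $<$ is a strict linear order; $a<b$ implies $a+c<b+c$; $0<c$ and $a<b$ imply $a\times c<b\times c$; if $a<b$ then there is $c$ with $a+c=b$; $0<1$ and $a>0$ implies $a\geq 1$; and $a\geq 0$ for all $a$. Elements of $N$ are identified with their values in $\overline{N}$. Let $N_{n}=\{na: a\in N\}$ be the set of elements of $N$ whose values in $\overline{N}$ are multiples of $n$. External representation: $\overline{N}^{n}=\{N_{n},+,\frac{\times}{n},<,0,n\}$, where $+$ and $<$ are those of $\overline{N}$ restricted to $N_{n}$, multiplication is $(na)\,\frac{\times}{n}\,(nb):=\frac{(na)\times(nb)}{n}=n(a\times b)$, the additive identity is $0$ and the multiplicative identity is $n$. Internal representation: $\overline{N}_{n}=\{N_{n},+_{n},\times_{n},<_{n},0_{n},1_{n}\}$ is the same structure with values renamed: the element whose value in $\overline{N}$ is $na$ has value denoted $a_{n}$ in $\overline{N}_{n}$, and the operations, the order relation and the constants are those of $\overline{N}^{n}$ transported along this renaming.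 *)

theory Defs
  imports Main
begin

record 'a arith_structure =
  carrier :: "'a set"
  add :: "'a \<Rightarrow> 'a \<Rightarrow> 'a"  (infixl \<open>\<oplus>\<index>\<close> 65)
  mult :: "'a \<Rightarrow> 'a \<Rightarrow> 'a"  (infixl \<open>\<otimes>\<index>\<close> 70)
  lt :: "'a \<Rightarrow> 'a \<Rightarrow> bool"  (infix \<open>\<prec>\<index>\<close> 50)
  zero :: 'a  (\<open>\<zero>\<index>\<close>)
  one :: 'a  (\<open>\<one>\<index>\<close>)

text \<open>The functions of a record are total on the ambient type. Being a structure for the
  language therefore includes closure of the carrier under the operations.\<close>

locale arith_structure =
  fixes M :: "'a arith_structure" (structure)
  assumes add_closed: "a \<in> carrier M \<Longrightarrow> b \<in> carrier M \<Longrightarrow> a \<oplus> b \<in> carrier M"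
    and mult_closed: "a \<in> carrier M \<Longrightarrow> b \<in> carrier M \<Longrightarrow> a \<otimes> b \<in> carrier M"
    and zero_closed: "\<zero> \<in> carrier M"
    and one_closed: "\<one> \<in> carrier M"

locale arithmetic = arith_structure +
  assumes add_assoc:
      "\<lbrakk>a \<in> carrier M; b \<in> carrier M; c \<in> carrier M\<rbrakk> \<Longrightarrow> (a \<oplus> b) \<oplus> c = a \<oplus> (b \<oplus> c)"
    and add_comm: "\<lbrakk>a \<in> carrier M; b \<in> carrier M\<rbrakk> \<Longrightarrow> a \<oplus> b = b \<oplus> a"
    and mult_assoc:
      "\<lbrakk>a \<in> carrier M; b \<in> carrier M; c \<in> carrier M\<rbrakk> \<Longrightarrow> (a \<otimes> b) \<otimes> c = a \<otimes> (b \<otimes> c)"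
    and mult_comm: "\<lbrakk>a \<in> carrier M; b \<in> carrier M\<rbrakk> \<Longrightarrow> a \<otimes> b = b \<otimes> a"
    and distrib:
      "\<lbrakk>a \<in> carrier M; b \<in> carrier M; c \<in> carrier M\<rbrakk> \<Longrightarrow> a \<otimes> (b \<oplus> c) = (a \<otimes> b) \<oplus> (a \<otimes> c)"
    and add_zero: "a \<in> carrier M \<Longrightarrow> a \<oplus> \<zero> = a"
    and mult_zero: "a \<in> carrier M \<Longrightarrow> a \<otimes> \<zero> = \<zero>"
    and mult_one: "a \<in> carrier M \<Longrightarrow> a \<otimes> \<one> = a"
    and lt_irrefl: "a \<in> carrier M \<Longrightarrow> \<not> a \<prec> a"
    and lt_trans:
      "\<lbrakk>a \<in> carrier M; b \<in> carrier M; c \<in> carrier M; a \<prec> b; b \<prec> c\<rbrakk> \<Longrightarrow> a \<prec> c"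
    and lt_total: "\<lbrakk>a \<in> carrier M; b \<in> carrier M\<rbrakk> \<Longrightarrow> a \<prec> b \<or> a = b \<or> b \<prec> a"
    and add_mono:
      "\<lbrakk>a \<in> carrier M; b \<in> carrier M; c \<in> carrier M; a \<prec> b\<rbrakk> \<Longrightarrow> a \<oplus> c \<prec> b \<oplus> c"
    and mult_mono:
      "\<lbrakk>a \<in> carrier M; b \<in> carrier M; c \<in> carrier M; \<zero> \<prec> c; a \<prec> b\<rbrakk> \<Longrightarrow> a \<otimes> c \<prec> b \<otimes> c"
    and lt_diff: "\<lbrakk>a \<in> carrier M; b \<in> carrier M; a \<prec> b\<rbrakk> \<Longrightarrow> \<exists>c\<in>carrier M. a \<oplus> c = b"
    and zero_lt_one: "\<zero> \<prec> \<one>"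
    and discrete: "\<lbrakk>a \<in> carrier M; \<zero> \<prec> a\<rbrakk> \<Longrightarrow> \<one> \<prec> a \<or> a = \<one>"
    and nonneg: "a \<in> carrier M \<Longrightarrow> \<zero> \<prec> a \<or> a = \<zero>"

definition nat_structure :: "nat arith_structure" where
  "nat_structure =
     \<lparr>carrier = UNIV, add = (+), mult = (*), lt = (<), zero = 0, one = 1\<rparr>"

definition multiples :: "nat \<Rightarrow> nat set" where
  "multiples n = {n * a | a. True}"

definition external_rep :: "nat \<Rightarrow> nat arith_structure" where
  "external_rep n =
     \<lparr>carrier = multiples n, add = (+), mult = (\<lambda>x y. (x * y) div n), lt = (<), zero = 0, one = n\<rparr>"

text \<open>\<open>Value a n\<close> is the value written \<open>a\<^sub>n\<close>. It is a name distinct from the number \<open>a\<close>.\<close>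

datatype scaled_value = Value nat nat

definition rename :: "nat \<Rightarrow> nat \<Rightarrow> scaled_value" where
  "rename n x = Value (x div n) n"

definition transport :: "('a \<Rightarrow> 'b) \<Rightarrow> 'a arith_structure \<Rightarrow> 'b arith_structure" where
  "transport f M =
     (let g = inv_into (carrier M) f in
      \<lparr>carrier = f ` carrier M,
       add = (\<lambda>x y. f (add M (g x) (g y))),
       mult = (\<lambda>x y. f (mult M (g x) (g y))),
       lt = (\<lambda>x y. lt M (g x) (g y)),
       zero = f (zero M),
       one = f (one M)\<rparr>)"

definition internal_rep :: "nat \<Rightarrow> scaled_value arith_structure" where
  "internal_rep n = transport (rename n) (external_rep n)"

text \<open>On multiples of \<open>n\<close> the truncating division in \<open>external_rep\<close> and \<open>rename\<close> is exact.\<close>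

lemma mult_external_rep:
  assumes "n > 0"
  shows "mult (external_rep n) (n * a) (n * b) = n * (a * b)"
  using assms by (simp add: external_rep_def)

lemma rename_multiple: "n > 0 \<Longrightarrow> rename n (n * a) = Value a n"
  by (simp add: rename_def)

lemma inj_on_rename: "n > 0 \<Longrightarrow> inj_on (rename n) (multiples n)"
  by (auto simp: inj_on_def multiples_def rename_def)

lemma inv_rename:
  assumes "n > 0"
  shows "inv_into (multiples n) (rename n) (Value a n) = n * a"
proof -
  have "n * a \<in> multiples n"
    by (auto simp: multiples_def)
  from inv_into_f_f[OF inj_on_rename[OF assms] this] show ?thesis
    by (simp add: rename_multiple assms)
qed

lemma internal_rep_simps:
  assumes "n > 0"
  shows "carrier (internal_rep n) = {Value a n | a. True}"
    and "add (internal_rep n) (Value a n) (Value b n) = Value (a + b) n"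
    and "mult (internal_rep n) (Value a n) (Value b n) = Value (a * b) n"
    and "lt (internal_rep n) (Value a n) (Value b n) \<longleftrightarrow> a < b"
    and "zero (internal_rep n) = Value 0 n"
    and "one (internal_rep n) = Value 1 n"
proof -
  have "rename n ` multiples n = {Value a n | a. True}"
    using assms by (auto simp: multiples_def image_iff rename_multiple) (metis rename_multiple)
  then show "carrier (internal_rep n) = {Value a n | a. True}"
    by (simp add: internal_rep_def transport_def external_rep_def Let_def)
qed (use assms in \<open>simp_all add: internal_rep_def transport_def external_rep_def Let_def
       inv_rename rename_def flip: distrib_left\<close>)

end

theory Submission
  imports Defs
begin

text \<open>Scaling by \<open>n\<close> does not change the structure, only the values that its elements have. The
  map \<open>a \<mapsto> n a\<close> is an isomorphism from the natural numbers onto the external representation: the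
  factor \<open>1/n\<close> in the scaled multiplication removes one of the two factors \<open>n\<close> in
  \<open>(n a) (n b)\<close>, and that is also why \<open>n\<close> becomes the multiplicative identity. Renaming the values is
  an isomorphism from the external onto the internal representation, because the internal
  operations are defined by transport along it. The axioms of arithmetic are first-order sentences,
  so isomorphic structures satisfy the same ones (\<open>arithmetic_iff_if_iso\<close>). Both equivalences are
  instances of this invariance.\<close>

text \<open>The operations of a record are total on the ambient type, so closure of \<open>carrier M\<close> is part
  of the notion: without it the value \<open>add M a b\<close> could lie outside the carrier, where the inverse
  of \<open>f\<close> does not recover it.\<close>

locale arith_iso = M: arith_structure M
  for M :: "'a arith_structure" +
  fixes N :: "'b arith_structure" and f :: "'a \<Rightarrow> 'b"
  assumes bij: "bij_betw f (carrier M) (carrier N)"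
    and add_hom: "\<lbrakk>a \<in> carrier M; b \<in> carrier M\<rbrakk> \<Longrightarrow> add N (f a) (f b) = f (add M a b)"
    and mult_hom: "\<lbrakk>a \<in> carrier M; b \<in> carrier M\<rbrakk> \<Longrightarrow> mult N (f a) (f b) = f (mult M a b)"
    and lt_iff: "\<lbrakk>a \<in> carrier M; b \<in> carrier M\<rbrakk> \<Longrightarrow> lt N (f a) (f b) \<longleftrightarrow> lt M a b"
    and zero_hom: "zero N = f (zero M)"
    and one_hom: "one N = f (one M)"
begin

lemma carrier_image: "carrier N = f ` carrier M"
  using bij by (simp add: bij_betw_def)

lemma eq_iff: "\<lbrakk>a \<in> carrier M; b \<in> carrier M\<rbrakk> \<Longrightarrow> f a = f b \<longleftrightarrow> a = b"
  using bij by (auto simp: bij_betw_def inj_on_def)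

lemma arith_structure_image: "arith_structure N"
  by unfold_locales
    (auto simp: carrier_image add_hom mult_hom zero_hom one_hom
      M.add_closed M.mult_closed M.zero_closed M.one_closed)

lemma iso_inv: "arith_iso N M (inv_into (carrier M) f)"
proof -
  interpret N: arith_structure N
    by (rule arith_structure_image)
  have inv: "inv_into (carrier M) f (f a) = a" if "a \<in> carrier M" for a
    using bij that by (simp add: bij_betw_def)
  show ?thesis
    by unfold_locales
      (use bij in \<open>auto simp: bij_betw_inv_into carrier_image add_hom mult_hom lt_iff zero_hom
        one_hom inv M.add_closed M.mult_closed M.zero_closed M.one_closed\<close>)
qed

text \<open>Every element of the image structure is the image of some element, so each axiom about
  elements \<open>f a\<close>, \<open>f b\<close>, \<open>f c\<close> is, by the homomorphism equations, the same axiom about \<open>a\<close>, \<open>b\<close>,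
  \<open>c\<close>. Surjectivity serves the universal quantifiers and injectivity serves the equations; the
  only existential axiom, the existence of differences, takes the image of the witness.\<close>

lemma arithmetic_image:
  assumes "arithmetic M"
  shows "arithmetic N"
proof -
  interpret A: arithmetic M
    by (rule assms)
  interpret N: arith_structure N
    by (rule arith_structure_image)
  note closed = M.add_closed M.mult_closed M.zero_closed M.one_closed
  note hom = add_hom mult_hom zero_hom one_hom lt_iff eq_iff
  show ?thesis
  proof unfold_locales
    fix a b assume "a \<in> carrier N" "b \<in> carrier N" "lt N a b"
    then obtain x y where xy: "x \<in> carrier M" "y \<in> carrier M" "a = f x" "b = f y" "lt M x y"
      by (auto simp: carrier_image lt_iff)
    from A.lt_diff[OF xy(1,2,5)] obtain z where "z \<in> carrier M" "add M x z = y" ..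
    with xy show "\<exists>c\<in>carrier N. add N a c = b"
      by (auto simp: carrier_image add_hom)
  qed (auto simp: carrier_image closed hom A.add_assoc A.mult_assoc A.distrib A.add_zero
      A.mult_zero A.mult_one A.lt_irrefl A.add_mono A.mult_mono A.zero_lt_one
      intro: A.add_comm A.mult_comm A.lt_trans dest: A.lt_total A.discrete A.nonneg)
qed

end

lemma arithmetic_iff_if_iso:
  assumes "arith_iso M N f"
  shows "arithmetic M \<longleftrightarrow> arithmetic N"
  using arith_iso.arithmetic_image[OF assms]
    arith_iso.arithmetic_image[OF arith_iso.iso_inv[OF assms]] by blast

lemma arith_iso_transport:
  assumes "arith_structure M" and inj: "inj_on f (carrier M)"
  shows "arith_iso M (transport f M) f"
proof -
  interpret arith_structure M
    by (rule assms(1))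
  show ?thesis
    by unfold_locales (simp_all add: transport_def Let_def inj inj_on_imp_bij_betw)
qed

lemma arith_iso_external_rep:
  assumes "n > 0"
  shows "arith_iso nat_structure (external_rep n) (\<lambda>a. n * a)"
proof -
  have "bij_betw (\<lambda>a. n * a) UNIV (multiples n)"
    using assms by (auto simp: bij_betw_def inj_on_def multiples_def)
  then show ?thesis
    by unfold_locales
      (use assms in \<open>simp_all add: nat_structure_def external_rep_def distrib_left\<close>)
qed

lemma arith_iso_internal_rep:
  assumes "n > 0"
  shows "arith_iso (external_rep n) (internal_rep n) (rename n)"
  unfolding internal_rep_def
proof (rule arith_iso_transport)
  show "arith_structure (external_rep n)"
    using arith_iso.arith_structure_image[OF arith_iso_external_rep[OF assms]] .
  show "inj_on (rename n) (carrier (external_rep n))"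
    using inj_on_rename[OF assms] by (simp add: external_rep_def)
qed

theorem theorem3:
  fixes n :: nat
  assumes "n > 0"
  shows "(arithmetic (internal_rep n) \<longleftrightarrow> arithmetic (external_rep n)) \<and>
         (arithmetic (external_rep n) \<longleftrightarrow> arithmetic nat_structure)"
  using arithmetic_iff_if_iso[OF arith_iso_internal_rep[OF assms]]
    arithmetic_iff_if_iso[OF arith_iso_external_rep[OF assms]] by blast

end
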